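(* Let $X\in\mathbb{R}^{n\times p}$ be a deterministic design matrix, let $T\subset\{1,\dots,p\}$ be any given nonempty set and assume that $\phi(1,T)>0$. Let $\lambda>0$ be arbitrary and consider the Lasso estimator $$\hat\beta\in\operatorname{argmin}_{\beta\in\mathbb{R}^p}\bigl\{\|X\beta-y\|^2+2\sqrt n\,\lambda\|\beta\|_1\bigr\},\qquad y=X\beta^*+\varepsilon.$$ Let $\gamma>0$ be any arbitrarily small constant. Assume that the random noise $\varepsilon\in\mathbb{R}^n$ satisfies $\mathbb{E}[\varepsilon]=0$ and $\mathbb{E}[\|\varepsilon\|^2]<+\infty$. Then there exists $\beta^*\in\mathbb{R}^p$ supported on $T$ such that $$(1-\gamma)\,\frac{\lambda|T|^{1/2}}{\phi(1,T)}\le\mathbb{E}\bigl[\|X(\hat\beta-\beta^* )\|\bigr].$$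
   Context: $\|\cdot\|$ is the Euclidean norm and $\|\cdot\|_1$ the $\ell_1$ norm. For $u\in\mathbb{R}^p$ and $S\subset\{1,\dots,p\}$, $u_S\in\mathbb{R}^p$ has coordinates $(u_S)_j=u_j$ if $j\in S$ and $0$ otherwise; $T^c=\{1,\dots,p\}\setminus T$. The compatibility constant (with constant $c_0=1$) is $$\phi(1,T)=\inf_{u\in\mathbb{R}^p:\ \|u_{T^c}\|_1<\|u_T\|_1}\frac{\sqrt{|T|}\,\|Xu\|}{\sqrt n\,(\|u_T\|_1-\|u_{T^c}\|_1)}.$$ "Supported on $T$" means $\beta^*_j=0$ for all $j\notin T$. *)

theory Defs
  imports "HOL-Probability.Probability"
begin

definition l1_norm :: "real ^ 'p \<Rightarrow> real"
  where "l1_norm u = (\<Sum>j\<in>UNIV. \<bar>u $ j\<bar>)"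

text \<open>The vector \<open>u\<^sub>S\<close>: it stays in the full space, with zero coordinates outside \<open>S\<close>.\<close>

definition restrict_vec :: "real ^ 'p \<Rightarrow> 'p set \<Rightarrow> real ^ 'p"
  where "restrict_vec u S = (\<chi> j. if j \<in> S then u $ j else 0)"

definition supported_on :: "real ^ 'p \<Rightarrow> 'p set \<Rightarrow> bool"
  where "supported_on b T \<longleftrightarrow> (\<forall>j. j \<notin> T \<longrightarrow> b $ j = 0)"

text \<open>
  The compatibility constant \<open>\<phi>(c\<^sub>0, T)\<close> for \<open>c\<^sub>0 = 1\<close>. For \<open>T \<noteq> {}\<close> the set below is nonempty
  and consists of nonnegative reals, so the real-valued \<open>Inf\<close> is the true infimum.
\<close>

definition compat_const :: "real ^ 'p ^ 'n \<Rightarrow> 'p set \<Rightarrow> real"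
  where "compat_const X T =
    Inf {sqrt (real (card T)) * norm (X *v u) /
           (sqrt (real CARD('n)) * (l1_norm (restrict_vec u T) - l1_norm (restrict_vec u (- T)))) | u.
         l1_norm (restrict_vec u (- T)) < l1_norm (restrict_vec u T)}"

definition lasso_objective :: "real ^ 'p ^ 'n \<Rightarrow> real \<Rightarrow> real ^ 'n \<Rightarrow> real ^ 'p \<Rightarrow> real"
  where "lasso_objective X lam y b =
    (norm (X *v b - y))\<^sup>2 + 2 * sqrt (real CARD('n)) * lam * l1_norm b"

text \<open>
  Minimizers need not be unique (although \<open>X *v b\<close> is the same for all of them), so being
  a Lasso estimate is a predicate on \<open>b\<close>.
\<close>

definition is_lasso :: "real ^ 'p ^ 'n \<Rightarrow> real \<Rightarrow> real ^ 'n \<Rightarrow> real ^ 'p \<Rightarrow> bool"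
  where "is_lasso X lam y b \<longleftrightarrow> is_arg_min (lasso_objective X lam y) (\<lambda>_. True) b"

end

theory Submission
  imports Defs
begin

text \<open>
  Let \<open>u\<close> nearly attain the compatibility constant, and let \<open>D\<close> be the difference of the
  \<open>\<ell>\<^sub>1\<close> norms of \<open>u\<^sub>T\<close> and of the rest of \<open>u\<close>. Take \<open>bstar = r u\<^sub>T\<close> with \<open>r\<close> large and
  test the optimality of the Lasso against \<open>bstar - r u\<close>, whose \<open>\<ell>\<^sub>1\<close> norm is smaller than that of
  \<open>bstar\<close> by \<open>r D\<close>. With \<open>h = bhat - bstar\<close> the variational inequality becomes
  \<open>r \<surd>n \<lambda> D \<le> r \<langle>\<epsilon>, Xu\<rangle> + r \<parallel>Xu\<parallel> \<parallel>Xh\<parallel> + (\<parallel>\<epsilon>\<parallel>\<^sup>2 + C\<^sup>2) / 2\<close>, where \<open>C\<close> does not depend on \<open>r\<close>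
  because positivity of the compatibility constant bounds \<open>\<parallel>bstar\<parallel>\<^sub>1 - \<parallel>bhat\<parallel>\<^sub>1\<close> by a multiple of
  \<open>\<parallel>Xh\<parallel>\<close>. Taking expectations and letting \<open>r\<close> tend to infinity gives the bound.
\<close>

section \<open>Arithmetic of the l1 norm and of restrictions\<close>

lemma l1_norm_nonneg [simp]: "0 \<le> l1_norm u"
  by (simp add: l1_norm_def sum_nonneg)

lemma l1_norm_triangle: "l1_norm (u + v) \<le> l1_norm u + l1_norm v"
  by (simp add: l1_norm_def sum.distrib [symmetric] sum_mono abs_triangle_ineq)

lemma l1_norm_scaleR [simp]: "l1_norm (c *\<^sub>R u) = \<bar>c\<bar> * l1_norm u"
  by (simp add: l1_norm_def abs_mult sum_distrib_left)

lemma restrict_vec_Compl_diff: "restrict_vec u T - u = - restrict_vec u (- T)"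
  by (simp add: vec_eq_iff restrict_vec_def)

text \<open>Coordinatewise: off \<open>T\<close> the vector \<open>b\<close> vanishes and the two
  contributions agree; on \<open>T\<close> this is the triangle inequality.\<close>

lemma l1_norm_diff_supported_on:
  assumes "supported_on b T"
  shows "l1_norm b - l1_norm b' \<le>
    l1_norm (restrict_vec (b' - b) T) - l1_norm (restrict_vec (b' - b) (- T))"
proof -
  have "l1_norm b + l1_norm (restrict_vec (b' - b) (- T))
      \<le> l1_norm b' + l1_norm (restrict_vec (b' - b) T)"
    using assms unfolding l1_norm_def supported_on_def sum.distrib [symmetric]
    by (intro sum_mono) (auto simp: restrict_vec_def)
  then show ?thesis by simp
qed

lemma continuous_on_l1_norm [continuous_intros]:
  "continuous_on S f \<Longrightarrow> continuous_on S (\<lambda>x. l1_norm (f x))"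
  unfolding l1_norm_def by (intro continuous_intros)

section \<open>Optimality, stability and existence of Lasso minimizers\<close>

lemma is_lasso_iff:
  "is_lasso X lam y b \<longleftrightarrow> (\<forall>b'. lasso_objective X lam y b \<le> lasso_objective X lam y b')"
  by (simp add: is_lasso_def is_arg_min_linorder)

text \<open>First-order optimality without subgradients: move from \<open>b\<close> a fraction
  \<open>t\<close> towards \<open>b'\<close>, bound the penalty by convexity, divide by
  \<open>t\<close> and let \<open>t\<close> tend to 0.\<close>

lemma is_lasso_variational:
  fixes X :: "real ^ 'p ^ 'n"
  assumes "is_lasso X lam y b" "lam \<ge> 0"
  shows "0 \<le> (X *v b - y) \<bullet> (X *v (b' - b))
    + sqrt (real CARD('n)) * lam * (l1_norm b' - l1_norm b)"
proof -
  let ?c = "sqrt (real CARD('n)) * lam"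
  define v where "v = X *v (b' - b)"
  define a where "a = 2 * ((X *v b - y) \<bullet> v) + 2 * ?c * (l1_norm b' - l1_norm b)"
  have c: "0 \<le> ?c" using assms by simp
  have *: "0 \<le> a + t * (norm v)\<^sup>2" if t: "0 < t" "t < 1" for t
  proof -
    have "X *v (b + t *\<^sub>R (b' - b)) - y = (X *v b - y) + t *\<^sub>R v"
      by (simp add: v_def matrix_vector_right_distrib matrix_vector_mult_scaleR)
    moreover have "(norm (p + t *\<^sub>R v))\<^sup>2 = (norm p)\<^sup>2 + 2 * t * (p \<bullet> v) + t\<^sup>2 * (norm v)\<^sup>2" for p
      unfolding power2_norm_eq_inner
      by (simp add: inner_add_left inner_add_right inner_commute power2_eq_square)
    ultimately have sq: "(norm (X *v (b + t *\<^sub>R (b' - b)) - y))\<^sup>2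
        = (norm (X *v b - y))\<^sup>2 + 2 * t * ((X *v b - y) \<bullet> v) + t\<^sup>2 * (norm v)\<^sup>2"
      by (simp only:)
    have "b + t *\<^sub>R (b' - b) = (1 - t) *\<^sub>R b + t *\<^sub>R b'"
      by (simp add: algebra_simps)
    then have "l1_norm (b + t *\<^sub>R (b' - b)) \<le> (1 - t) * l1_norm b + t * l1_norm b'"
      using l1_norm_triangle [of "(1 - t) *\<^sub>R b" "t *\<^sub>R b'"] t by simp
    then have "?c * l1_norm (b + t *\<^sub>R (b' - b))
        \<le> ?c * ((1 - t) * l1_norm b + t * l1_norm b')"
      using c by (rule mult_left_mono)
    moreover have "lasso_objective X lam y b \<le> lasso_objective X lam y (b + t *\<^sub>R (b' - b))"
      using assms(1) by (simp add: is_lasso_iff)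
    ultimately have "0 \<le> t * (a + t * (norm v)\<^sup>2)"
      unfolding lasso_objective_def sq a_def by (simp add: algebra_simps power2_eq_square)
    with t show ?thesis by (simp add: zero_le_mult_iff)
  qed
  have "((\<lambda>t. a + t * (norm v)\<^sup>2) \<longlongrightarrow> a + 0 * (norm v)\<^sup>2) (at_right 0)"
    by (intro tendsto_intros)
  moreover have "\<forall>\<^sub>F t in at_right 0. 0 \<le> a + t * (norm v)\<^sup>2"
    using eventually_at_right_less eventually_at_right_real [OF zero_less_one]
    by (auto elim!: eventually_mono intro!: *)
  ultimately have "0 \<le> a + 0 * (norm v)\<^sup>2"
    by (rule tendsto_lowerbound) simp
  then show ?thesis by (simp add: a_def v_def)
qed

text \<open>Test each minimizer against the other and add: the penalties cancel and Cauchy-Schwarz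
  finishes. With \<open>y1 = y2\<close> this makes the fit unique.\<close>

lemma lasso_fit_nonexpansive:
  fixes X :: "real ^ 'p ^ 'n"
  assumes "is_lasso X lam y1 b1" "is_lasso X lam y2 b2" "lam \<ge> 0"
  shows "norm (X *v b1 - X *v b2) \<le> norm (y1 - y2)"
proof -
  let ?d = "X *v b1 - X *v b2"
  have "0 \<le> (X *v b1 - y1) \<bullet> (X *v (b2 - b1)) + (X *v b2 - y2) \<bullet> (X *v (b1 - b2))"
    using is_lasso_variational [OF assms(1,3), of b2] is_lasso_variational [OF assms(2,3), of b1]
    by (simp add: algebra_simps)
  also have "\<dots> = (y1 - y2) \<bullet> ?d - (norm ?d)\<^sup>2"
    by (simp add: matrix_vector_mult_diff_distrib power2_norm_eq_inner inner_diff_left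
        inner_diff_right inner_commute)
  finally have "(norm ?d)\<^sup>2 \<le> norm (y1 - y2) * norm ?d"
    using norm_cauchy_schwarz [of "y1 - y2" ?d] by linarith
  then show ?thesis
    by (cases "norm ?d = 0") (simp_all add: power2_eq_square)
qed

lemma is_lasso_exists:
  fixes X :: "real ^ 'p ^ 'n"
  assumes "lam > 0"
  shows "\<exists>b. is_lasso X lam y b"
proof -
  let ?f = "lasso_objective X lam y" and ?c = "2 * sqrt (real CARD('n)) * lam"
  \<comment> \<open>Outside this ball the penalty alone exceeds the objective at 0, so a minimizer
    over the ball is global.\<close>
  define R where "R = ?f 0 / ?c"
  have c: "0 < ?c" using assms by simp
  have R: "0 \<le> R" using assms by (simp add: R_def lasso_objective_def)
  have "continuous_on (cball 0 R) ?f"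
    unfolding lasso_objective_def
    by (intro continuous_intros linear_continuous_on_compose [OF continuous_on_id])
      (simp_all add: matrix_vector_mul_linear)
  then obtain b where b: "b \<in> cball 0 R" "\<And>b'. b' \<in> cball 0 R \<Longrightarrow> ?f b \<le> ?f b'"
    using R continuous_attains_inf [of "cball 0 R" ?f] by auto
  have "?f b \<le> ?f b'" if "b' \<notin> cball 0 R" for b'
  proof -
    have "?f b \<le> ?f 0" using b R by simp
    also have "\<dots> = ?c * R" using assms by (simp add: R_def)
    also have "\<dots> \<le> ?c * norm b'" using that c by (intro mult_left_mono) auto
    also have "\<dots> \<le> ?c * l1_norm b'"
      unfolding l1_norm_def using c by (intro mult_left_mono norm_le_l1_cart) auto
    also have "\<dots> \<le> ?f b'" by (simp add: lasso_objective_def)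
    finally show ?thesis .
  qed
  with b(2) show ?thesis unfolding is_lasso_iff by blast
qed

text \<open>
  Although \<open>bhat\<close> is an arbitrary selection of minimizers, the fit is a continuous function of
  the noise, so its expectation is not a junk value.
\<close>

lemma integrable_lasso_error:
  fixes X :: "real ^ 'p ^ 'n" and bhat :: "'w \<Rightarrow> real ^ 'p"
  assumes "lam > 0" "finite_measure M" "integrable M eps"
    and bhat: "\<And>w. w \<in> space M \<Longrightarrow> is_lasso X lam (X *v b + eps w) (bhat w)"
  shows "integrable M (\<lambda>w. norm (X *v (bhat w - b)))"
proof -
  interpret finite_measure M by fact
  \<comment> \<open>One fixed choice of minimizer per noise value; by uniqueness of the fit, every
    selection \<open>bhat\<close> satisfies \<open>X *v bhat w = g (eps w)\<close>.\<close>
  define g where "g e = X *v (SOME b'. is_lasso X lam (X *v b + e) b')" for e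
  have lasso: "is_lasso X lam (X *v b + e) (SOME b'. is_lasso X lam (X *v b + e) b')" for e
    using is_lasso_exists [OF assms(1)] by (rule someI_ex)
  have g: "X *v (bhat w) = g (eps w)" if "w \<in> space M" for w
    using lasso_fit_nonexpansive [OF bhat [OF that] lasso [of "eps w"]] assms(1)
    by (simp add: g_def)
  have lip: "dist (g x) (g y) \<le> dist x y" for x y
    using lasso_fit_nonexpansive [OF lasso [of x] lasso [of y]] assms(1)
    by (simp add: g_def dist_norm)
  then have "continuous_on UNIV g"
    by (metis continuous_on_iff le_less_trans)
  then have [measurable]: "g \<in> borel_measurable borel"
    by (rule borel_measurable_continuous_onI)
  have [measurable]: "eps \<in> borel_measurable M" using assms(3) by simp
  have "integrable M (\<lambda>w. norm (g (eps w) - X *v b))"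
  proof (rule Bochner_Integration.integrable_bound)
    show "integrable M (\<lambda>w. norm (eps w) + norm (g 0 - X *v b))"
      using assms(3) by simp
    have "norm (g e - X *v b) \<le> norm e + norm (g 0 - X *v b)" for e
      using lip [of e 0] norm_triangle_ineq [of "g e - g 0" "g 0 - X *v b"]
      by (simp add: dist_norm)
    then show "AE w in M. norm (norm (g (eps w) - X *v b))
        \<le> norm (norm (eps w) + norm (g 0 - X *v b))"
      by simp
  qed measurable
  then show ?thesis
    by (subst Bochner_Integration.integrable_cong [OF refl, where g = "\<lambda>w. norm (g (eps w) - X *v b)"])
      (simp_all add: matrix_vector_mult_diff_distrib g)
qed

section \<open>The compatibility constant as an infimum\<close>

lemma compat_const_le:
  fixes X :: "real ^ 'p ^ 'n"
  assumes "l1_norm (restrict_vec u (- T)) < l1_norm (restrict_vec u T)"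
  shows "compat_const X T \<le> sqrt (real (card T)) * norm (X *v u) /
    (sqrt (real CARD('n)) * (l1_norm (restrict_vec u T) - l1_norm (restrict_vec u (- T))))"
  unfolding compat_const_def
proof (rule cInf_lower)
  show "bdd_below {sqrt (real (card T)) * norm (X *v u) /
      (sqrt (real CARD('n)) * (l1_norm (restrict_vec u T) - l1_norm (restrict_vec u (- T)))) | u.
      l1_norm (restrict_vec u (- T)) < l1_norm (restrict_vec u T)}"
    by (rule bdd_belowI [of _ 0]) auto
qed (use assms in blast)

lemma compat_const_less_ex:
  fixes X :: "real ^ 'p ^ 'n"
  assumes "T \<noteq> {}" "compat_const X T < z"
  shows "\<exists>u. l1_norm (restrict_vec u (- T)) < l1_norm (restrict_vec u T) \<and>
    sqrt (real (card T)) * norm (X *v u) / (sqrt (real CARD('n)) *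
      (l1_norm (restrict_vec u T) - l1_norm (restrict_vec u (- T)))) < z"
proof -
  obtain j where "j \<in> T" using assms(1) by blast
  \<comment> \<open>A coordinate vector in \<open>T\<close> is admissible, so the infimum is over a
    nonempty set.\<close>
  have "l1_norm (restrict_vec (axis j 1) (- T)) = 0"
    using \<open>j \<in> T\<close> unfolding l1_norm_def restrict_vec_def
    by (intro sum.neutral) (auto simp: axis_def)
  moreover have "0 < l1_norm (restrict_vec (axis j 1) T)"
    using \<open>j \<in> T\<close> unfolding l1_norm_def
    by (intro sum_pos2 [of _ j]) (auto simp: restrict_vec_def axis_def)
  ultimately have "\<exists>u :: real ^ 'p. l1_norm (restrict_vec u (- T)) < l1_norm (restrict_vec u T)"
    by metis
  then show ?thesis
    using cInf_lessD [OF _ assms(2) [unfolded compat_const_def]] by blast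
qed

text \<open>Outside the cone the left side is nonpositive, so the bound holds for every
  \<open>u\<close>. It will be applied to the estimation error, which need not lie in the
  cone.\<close>

lemma compat_const_l1_bound:
  fixes X :: "real ^ 'p ^ 'n"
  assumes "compat_const X T > 0"
  shows "sqrt (real CARD('n)) * (l1_norm (restrict_vec u T) - l1_norm (restrict_vec u (- T)))
    \<le> sqrt (real (card T)) / compat_const X T * norm (X *v u)"
proof (cases "l1_norm (restrict_vec u (- T)) < l1_norm (restrict_vec u T)")
  case True
  let ?D = "sqrt (real CARD('n)) * (l1_norm (restrict_vec u T) - l1_norm (restrict_vec u (- T)))"
  have "0 < ?D" using True by simp
  then have "compat_const X T * ?D \<le> sqrt (real (card T)) * norm (X *v u)"
    using compat_const_le [OF True, of X] by (simp only: pos_le_divide_eq)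
  then show ?thesis using assms by (simp add: pos_le_divide_eq mult.commute)
next
  case False
  then have "sqrt (real CARD('n)) * (l1_norm (restrict_vec u T) - l1_norm (restrict_vec u (- T))) \<le> 0"
    by (simp add: mult_nonneg_nonpos)
  also have "0 \<le> sqrt (real (card T)) / compat_const X T * norm (X *v u)"
    using assms by simp
  finally show ?thesis .
qed

section \<open>The lower bound on the prediction error\<close>

lemma lasso_error_pointwise:
  fixes X :: "real ^ 'p ^ 'n" and u :: "real ^ 'p" and T :: "'p set"
  defines "D \<equiv> l1_norm (restrict_vec u T) - l1_norm (restrict_vec u (- T))"
    and "b \<equiv> \<lambda>r. r *\<^sub>R restrict_vec u T"
  assumes phi: "compat_const X T > 0" and lam: "lam \<ge> 0" and r: "r \<ge> 0"
    and lasso: "is_lasso X lam (X *v b r + e) bhat"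
  shows "r * (sqrt (real CARD('n)) * lam * D) \<le> r * (e \<bullet> (X *v u))
    + r * norm (X *v u) * norm (X *v (bhat - b r))
    + ((norm e)\<^sup>2 + (lam * (sqrt (real (card T)) / compat_const X T))\<^sup>2) / 2"
proof -
  let ?c = "sqrt (real CARD('n)) * lam"
  define C where "C = lam * (sqrt (real (card T)) / compat_const X T)"
  define h where "h = bhat - b r"
  \<comment> \<open>The block on \<open>T\<close> cancels, leaving \<open>- r\<close> times the part
    of \<open>u\<close> outside \<open>T\<close>.\<close>
  define b' where "b' = b r - r *\<^sub>R u"
  have "b' = r *\<^sub>R (- restrict_vec u (- T))"
    by (simp only: b'_def b_def restrict_vec_Compl_diff [symmetric] scaleR_diff_right)
  then have b': "b' = (- r) *\<^sub>R restrict_vec u (- T)" by simp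
  have l1: "l1_norm b' = l1_norm (b r) - r * D"
    unfolding b' l1_norm_scaleR using r by (simp add: b_def D_def algebra_simps)
  have supp: "supported_on (b r) T"
    by (simp add: b_def supported_on_def restrict_vec_def)
  have "sqrt (real CARD('n)) * (l1_norm (b r) - l1_norm bhat) \<le>
      sqrt (real CARD('n)) * (l1_norm (restrict_vec h T) - l1_norm (restrict_vec h (- T)))"
    unfolding h_def by (intro mult_left_mono l1_norm_diff_supported_on supp) simp
  also have "\<dots> \<le> sqrt (real (card T)) / compat_const X T * norm (X *v h)"
    by (rule compat_const_l1_bound [OF phi])
  finally have l1_le: "?c * (l1_norm (b r) - l1_norm bhat) \<le> C * norm (X *v h)"
    using mult_left_mono [OF _ lam] by (fastforce simp: C_def mult_ac)
  have fit: "X *v bhat - (X *v b r + e) = X *v h - e"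
    by (simp add: h_def matrix_vector_mult_diff_distrib)
  have dir: "X *v (b' - bhat) = - (X *v h) - r *\<^sub>R (X *v u)"
    by (simp add: b'_def h_def matrix_vector_mult_diff_distrib matrix_vector_mult_scaleR)
  have var: "0 \<le> (X *v bhat - (X *v b r + e)) \<bullet> (X *v (b' - bhat))
      + ?c * (l1_norm b' - l1_norm bhat)"
    by (rule is_lasso_variational [OF lasso lam])
  have "r * (?c * D) \<le> (X *v h - e) \<bullet> (- (X *v h) - r *\<^sub>R (X *v u))
      + C * norm (X *v h)"
    using l1_le var unfolding fit dir l1 by (simp only: right_diff_distrib) (simp add: mult_ac)
  also have "\<dots> = r * (e \<bullet> (X *v u)) - r * ((X *v h) \<bullet> (X *v u)) + e \<bullet> (X *v h)
      - (norm (X *v h))\<^sup>2 + C * norm (X *v h)"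
    by (simp add: inner_diff_left inner_diff_right power2_norm_eq_inner algebra_simps)
  also have "\<dots> \<le> r * (e \<bullet> (X *v u)) + r * (norm (X *v u) * norm (X *v h))
      + norm e * norm (X *v h) - (norm (X *v h))\<^sup>2 + C * norm (X *v h)"
  proof -
    have "- ((X *v h) \<bullet> (X *v u)) \<le> norm (X *v u) * norm (X *v h)"
      using norm_cauchy_schwarz [of "- (X *v h)" "X *v u"] by (simp add: mult.commute)
    from mult_left_mono [OF this r] show ?thesis
      using norm_cauchy_schwarz [of e "X *v h"] by simp
  qed
  \<comment> \<open>The negative square absorbs both cross terms, half of it for each, via 2xy \<le>
    x^2 + y^2.\<close>
  also have "\<dots> \<le> r * (e \<bullet> (X *v u)) + r * (norm (X *v u) * norm (X *v h))
      + ((norm e)\<^sup>2 + C\<^sup>2) / 2"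
    using zero_le_power2 [of "norm e - norm (X *v h)"] zero_le_power2 [of "C - norm (X *v h)"]
    by (simp add: power2_diff)
  finally show ?thesis by (simp add: C_def h_def mult.assoc)
qed

theorem theorem3p1:
  fixes X :: "real ^ 'p ^ 'n"
    and T :: "'p set"
    and lam gam :: real
    and M :: "'w measure"
    and eps :: "'w \<Rightarrow> real ^ 'n"
  assumes "T \<noteq> {}"
    and "compat_const X T > 0"
    and "lam > 0"
    and "gam > 0"
    and "prob_space M"
    and "eps \<in> borel_measurable M"
    and "integrable M (\<lambda>w. (norm (eps w))\<^sup>2)"
    and "prob_space.expectation M eps = 0"
  shows "\<exists>bstar. supported_on bstar T \<and>
    (\<forall>bhat :: 'w \<Rightarrow> real ^ 'p.
       (\<forall>w\<in>space M. is_lasso X lam (X *v bstar + eps w) (bhat w)) \<longrightarrow>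
       (1 - gam) * (lam * sqrt (real (card T)) / compat_const X T)
         \<le> prob_space.expectation M (\<lambda>w. norm (X *v (bhat w - bstar))))"
proof (cases "gam < 1")
  case False
  have "(1 - gam) * (lam * sqrt (real (card T)) / compat_const X T) \<le> 0"
    using False assms by (intro mult_nonpos_nonneg) auto
  then show ?thesis
    by (intro exI [of _ 0]) (auto simp: supported_on_def intro: order_trans)
next
  case True
  interpret prob_space M by fact
  let ?phi = "compat_const X T" and ?n = "sqrt (real CARD('n))"
  define C where "C = lam * (sqrt (real (card T)) / ?phi)"
  define K where "K = (expectation (\<lambda>w. (norm (eps w))\<^sup>2) + C\<^sup>2) / 2"
  \<comment> \<open>A nonintegrable function has Bochner integral 0 by default, so integrability
    does not follow from the mean-zero hypothesis.\<close>
  have eps: "integrable M eps"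
  proof (rule Bochner_Integration.integrable_bound)
    show "integrable M (\<lambda>w. 1 + (norm (eps w))\<^sup>2)" using assms(7) by simp
    have "t \<le> 1 + t\<^sup>2" for t :: real
      using sum_squares_bound [of t 1] zero_le_power2 [of t]
      unfolding power_one mult_1_right by linarith
    then show "AE w in M. norm (eps w) \<le> norm (1 + (norm (eps w))\<^sup>2)" by simp
  qed (use assms in simp)
  \<comment> \<open>The infimum need not be attained; the factor 1 - \<open>gam\<close> pays for a
    near-minimizer.\<close>
  have "?phi < ?phi / (1 - gam)"
    using True assms by (simp add: field_simps)
  from compat_const_less_ex [OF assms(1) this] obtain u where
    u: "l1_norm (restrict_vec u (- T)) < l1_norm (restrict_vec u T)" and
    lt: "sqrt (real (card T)) * norm (X *v u) / (?n *
      (l1_norm (restrict_vec u T) - l1_norm (restrict_vec u (- T)))) < ?phi / (1 - gam)"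
    by blast
  define D where "D = l1_norm (restrict_vec u T) - l1_norm (restrict_vec u (- T))"
  define N where "N = norm (X *v u)"
  have D: "0 < ?n * D" using u by (simp add: D_def)
  \<comment> \<open>If \<open>N\<close> were 0, the quotient at \<open>u\<close> would be 0, forcing
    the constant to be nonpositive.\<close>
  have N: "0 < N"
    using compat_const_le [OF u, of X] assms(2) by (auto simp: N_def)
  have "sqrt (real (card T)) * N * (1 - gam) < ?phi * (?n * D)"
    using lt D True unfolding D_def [symmetric] N_def [symmetric] by (simp add: field_simps)
  then have "(1 - gam) * (sqrt (real (card T)) / ?phi) * N < ?n * D"
    using assms(2) by (simp add: field_simps)
  then have "lam * ((1 - gam) * (sqrt (real (card T)) / ?phi) * N) < lam * (?n * D)"
    using assms(3) by (rule mult_strict_left_mono)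
  then have gap: "0 < ?n * lam * D - (1 - gam) * C * N"
    by (simp add: C_def mult_ac)
  \<comment> \<open>The strict gap lets one finite \<open>r\<close> replace the limit:
    \<open>r\<close> times the gap dominates \<open>K\<close>, and \<open>r\<close> is fixed before
    \<open>bhat\<close>.\<close>
  define r where "r = (\<bar>K\<bar> + 1) / (?n * lam * D - (1 - gam) * C * N)"
  have r: "0 < r" using gap by (simp add: r_def add_nonneg_pos)
  have rK: "K \<le> r * (?n * lam * D - (1 - gam) * C * N)" using gap by (simp add: r_def)
  let ?b = "r *\<^sub>R restrict_vec u T"
  show ?thesis
  proof (intro exI [of _ ?b] conjI allI impI)
    show "supported_on ?b T" by (simp add: supported_on_def restrict_vec_def)
  next
    fix bhat :: "'w \<Rightarrow> real ^ 'p"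
    assume lasso: "\<forall>w\<in>space M. is_lasso X lam (X *v ?b + eps w) (bhat w)"
    let ?E = "expectation (\<lambda>w. norm (X *v (bhat w - ?b)))"
    have err: "integrable M (\<lambda>w. norm (X *v (bhat w - ?b)))"
      using lasso by (intro integrable_lasso_error [OF assms(3) finite_measure_axioms eps]) auto
    have "expectation (\<lambda>w. r * (?n * lam * D)) \<le> expectation (\<lambda>w. r * (eps w \<bullet> (X *v u))
        + r * N * norm (X *v (bhat w - ?b)) + ((norm (eps w))\<^sup>2 + C\<^sup>2) / 2)"
    proof (rule integral_mono)
      show "integrable M (\<lambda>w. r * (eps w \<bullet> (X *v u))
        + r * N * norm (X *v (bhat w - ?b)) + ((norm (eps w))\<^sup>2 + C\<^sup>2) / 2)"
        using eps err assms(7) by simp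
      show "r * (?n * lam * D) \<le> r * (eps w \<bullet> (X *v u))
        + r * N * norm (X *v (bhat w - ?b)) + ((norm (eps w))\<^sup>2 + C\<^sup>2) / 2"
        if "w \<in> space M" for w
        unfolding N_def C_def D_def using lasso that assms r
        by (intro lasso_error_pointwise) auto
    qed simp
    \<comment> \<open>The term linear in the noise vanishes because \<open>eps\<close> is
      centered.\<close>
    also have "\<dots> = r * N * ?E + K"
      using eps err assms(7,8) by (simp add: K_def prob_space)
    finally have "r * (?n * lam * D) \<le> r * N * ?E + K" by (simp add: prob_space)
    with rK have "r * (N * ((1 - gam) * C)) \<le> r * (N * ?E)" by (simp add: algebra_simps)
    with r N have "(1 - gam) * C \<le> ?E" by simp
    then show "(1 - gam) * (lam * sqrt (real (card T)) / ?phi) \<le> ?E"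
      by (simp add: C_def)
  qed
qed

end
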